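(* Let $(G,+)$ be a countable abelian group and let $(X,\mathcal A,\mu,(T_g)_{g\in G})$ be a measure preserving system. For $\ell\in\mathbb N$, $\epsilon>0$ and $A_0,\dots,A_\ell\in\mathcal A$ let $$R_\epsilon(A_0,\dots,A_\ell)=\Big\{(g_1,\dots,g_\ell)\in G^\ell : \Big|\mu(A_0\cap T_{g_1}A_1\cap\cdots\cap T_{g_\ell}A_\ell)-\prod_{j=0}^\ell\mu(A_j)\Big|<\epsilon\Big\}.$$ The following statements are equivalent: (i) $(T_g)_{g\in G}$ is strongly mixing. (ii) For any $\ell\in\mathbb N$, any $A_0,\dots,A_\ell\in\mathcal A$ and any $\epsilon>0$, the set $R_\epsilon(A_0,\dots,A_\ell)$ is $\tilde\Sigma_\ell^*$ in $G^\ell$. (iii) There exists an $\ell\in\mathbb N$ such that for any $A_0,\dots,A_\ell\in\mathcal A$ and any $\epsilon>0$, the set $R_\epsilon(A_0,\dots,A_\ell)$ is $\tilde\Sigma_\ell^*$ in $G^\ell$.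
   Context: $\mathbb N=\{1,2,\dots\}$. A measure preserving system $(X,\mathcal A,\mu,(T_g)_{g\in G})$ consists of a separable probability space and an action of the countable discrete abelian group $G$ on it by (invertible) $\mu$-preserving transformations; as a standing assumption the space is regular, i.e. $X$ is a compact metric space and $\mathcal A=\mathrm{Borel}(X)$. For a sequence in $G$, $\lim_{k\to\infty}g_k=\infty$ means that for every finite $F\subseteq G$, $g_k\notin F$ for all large $k$. The system is strongly mixing if $\lim_{g\to\infty}\mu(A_0\cap T_gA_1)=\mu(A_0)\mu(A_1)$ for all $A_0,A_1\in\mathcal A$. A set $E\subseteq G^d$ is a $\tilde\Sigma_m$ set if $E=\{\mathbf g^{(1)}_{k_1}+\cdots+\mathbf g^{(m)}_{k_m} : k_1<\cdots<k_m\}$ (with $k_1,\dots,k_m\in\mathbb N$) where for each $j\in\{1,\dots,m\}$, $(\mathbf g^{(j)}_k)_{k\in\mathbb N}=(g^{(j)}_{k,1},\dots,g^{(j)}_{k,d})_{k\in\mathbb N}$ is a sequence in $G^d$ such that $\lim_{k\to\infty}g^{(j)}_{k,t}=\infty$ for each $t\in\{1,\dots,d\}$ and $\lim_{k\to\infty}(g^{(j)}_{k,t}-g^{(j)}_{k,t'})=\infty$ for distinct $t,t'\in\{1,\dots,d\}$. A subset of $G^d$ is $\tilde\Sigma_m^*$ if it has non-empty intersection with every $\tilde\Sigma_m$ set in $G^d$. *)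

theory Defs
  imports "HOL-Probability.Probability"
begin

text \<open>
  The compact metric space \<open>X\<close> is a type, so the algebra of measurable sets is the
  Borel algebra of the whole type. The acting group is a type as well; \<open>T g\<close> is invertible
  with inverse \<open>T (- g)\<close> by the action laws.
\<close>

locale measure_preserving_system = prob_space M
  for M :: "'x::metric_space measure"
    and T :: "'g::{ab_group_add,countable} \<Rightarrow> 'x \<Rightarrow> 'x" +
  assumes compact_space: "compact (UNIV :: 'x set)"
    and sets_borel: "sets M = sets borel"
    and act_zero: "T 0 = id"
    and act_add: "T (g + h) = T g \<circ> T h"
    and measurable_act: "T g \<in> M \<rightarrow>\<^sub>M M"
    and distr_act: "distr M M (T g) = M"

text \<open>
  Since \<open>G\<close> is discrete, \<open>g \<rightarrow> \<infinity>\<close> is the filter \<open>cofinite\<close>. It is trivial when \<open>G\<close> is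
  finite: then every action is strongly mixing and no sequence tends to infinity.
\<close>

definition strongly_mixing :: "'x measure \<Rightarrow> ('g \<Rightarrow> 'x \<Rightarrow> 'x) \<Rightarrow> bool" where
  "strongly_mixing M T \<longleftrightarrow>
    (\<forall>A\<^sub>0\<in>sets M. \<forall>A\<^sub>1\<in>sets M.
      ((\<lambda>g. measure M (A\<^sub>0 \<inter> T g ` A\<^sub>1)) \<longlongrightarrow> measure M A\<^sub>0 * measure M A\<^sub>1) cofinite)"

text \<open>Tuples in \<open>G\<^sup>d\<close> are functions on \<open>{1..d}\<close>, extended by \<^const>\<open>undefined\<close>.\<close>

definition tuples :: "nat \<Rightarrow> (nat \<Rightarrow> 'g) set" where
  "tuples d = {1..d} \<rightarrow>\<^sub>E UNIV"

text \<open>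
  \<open>g j k t\<close> is the \<open>t\<close>-th coordinate of the \<open>k\<close>-th term of the \<open>j\<close>-th sequence. Sequences are
  indexed by \<open>k \<ge> 1\<close>; the values \<open>g j 0\<close> are never used.
\<close>

definition Sigma_tilde_set :: "nat \<Rightarrow> nat \<Rightarrow> (nat \<Rightarrow> 'g::ab_group_add) set \<Rightarrow> bool" where
  "Sigma_tilde_set m d E \<longleftrightarrow>
    (\<exists>g :: nat \<Rightarrow> nat \<Rightarrow> nat \<Rightarrow> 'g.
      (\<forall>j\<in>{1..m}.
        (\<forall>k\<ge>1. g j k \<in> tuples d) \<and>
        (\<forall>t\<in>{1..d}. filterlim (\<lambda>k. g j k t) cofinite sequentially) \<and>
        (\<forall>t\<in>{1..d}. \<forall>t'\<in>{1..d}. t \<noteq> t' \<longrightarrow>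
          filterlim (\<lambda>k. g j k t - g j k t') cofinite sequentially)) \<and>
      E = {\<lambda>t\<in>{1..d}. \<Sum>j=1..m. g j (k j) t | k :: nat \<Rightarrow> nat.
            k \<in> {1..m} \<rightarrow> {1..} \<and> strict_mono_on {1..m} k})"

definition Sigma_tilde_star :: "nat \<Rightarrow> nat \<Rightarrow> (nat \<Rightarrow> 'g::ab_group_add) set \<Rightarrow> bool" where
  "Sigma_tilde_star m d S \<longleftrightarrow>
    S \<subseteq> tuples d \<and> (\<forall>E. Sigma_tilde_set m d E \<longrightarrow> S \<inter> E \<noteq> {})"

definition mixing_returns ::
    "'x measure \<Rightarrow> ('g \<Rightarrow> 'x \<Rightarrow> 'x) \<Rightarrow> nat \<Rightarrow> (nat \<Rightarrow> 'x set) \<Rightarrow> real \<Rightarrow> (nat \<Rightarrow> 'g) set" where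
  "mixing_returns M T l A \<epsilon> =
    {g \<in> tuples l.
      \<bar>measure M (A 0 \<inter> (\<Inter>j\<in>{1..l}. T (g j) ` A j)) - (\<Prod>j=0..l. measure M (A j))\<bar> < \<epsilon>}"

end

theory Submission
  imports Defs "HOL-Library.Ramsey"
begin

text \<open>
  Both directions rest on one inequality of Bessel type, \<open>sum_abs_correlation_le\<close>: if the events
  \<open>W\<^sub>1, \<dots>, W\<^sub>N\<close> all have probability about \<open>c\<close> and their pairwise intersections have probability
  about \<open>c\<^sup>2\<close>, then the centred indicators are almost orthogonal, so every event \<open>B\<close> is almost
  independent of most of the \<open>W\<^sub>i\<close>.

  Suppose the action is strongly mixing. Regard an element of a \<open>\<Sigma>\<^sub>l\<close> set in \<open>G\<^sup>l\<close> as a sum over \<open>l\<close>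
  levels, the outermost level having the smallest index \<open>k\<close>, and sum from the innermost level on. The claim, by induction on the number \<open>m\<close>
  of levels summed, is that any \<open>m + 1\<close> of the coordinates \<open>0, \<dots>, l\<close> are almost independent for a
  suitable choice of indices, simultaneously for finitely many families of sets
  (\<open>independent_along\<close>). For the step take \<open>m + 2\<close> coordinates and single out one of them, \<open>s\<close>.
  By invariance of the measure the new level shifts coordinate \<open>t \<noteq> s\<close> by \<open>a\<^sub>k t - a\<^sub>k s\<close>, which
  tends to infinity, and leaves \<open>s\<close> alone. For many values of \<open>k\<close> let \<open>W\<^sub>k\<close> be the intersection of
  the shifted sets over the coordinates other than \<open>s\<close>. The probabilities of \<open>W\<^sub>k\<close> and
  \<open>W\<^sub>k \<inter> W\<^sub>k'\<close> concern only \<open>m + 1\<close> coordinates, so the induction hypothesis turns them into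
  products, and mixing makes the factors of \<open>W\<^sub>k \<inter> W\<^sub>k'\<close> close to squares. The inequality then
  yields a \<open>k\<close> for which \<open>W\<^sub>k\<close> is almost independent of the set in coordinate \<open>s\<close>. With all \<open>l\<close>
  levels summed, all \<open>l + 1\<close> coordinates are almost independent.

  Conversely, let the return sets be \<open>\<Sigma>\<^sub>l\<^sup>*\<close> for one \<open>l\<close>. Taking \<open>A\<^sub>j\<close> to be the whole space for
  \<open>j \<ge> 2\<close> leaves a statement about a single coordinate: along sums \<open>b\<^sub>1(k\<^sub>1) + \<dots> + b\<^sub>l(k\<^sub>l)\<close> of
  sequences tending to infinity, some correlation is small (\<open>small_correlations\<close>). An arbitrary
  infinite set need not contain such sums, so failure of mixing for two given sets does not
  contradict this directly. Instead the number of summands is lowered to one. From \<open>r\<close> to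
  \<open>r + 1\<close> summands one passes by absorbing one summand into a set, and from \<open>2r\<close> back to \<open>r\<close> by
  applying the property to \<open>-b\<^sub>1, \<dots>, -b\<^sub>r, b\<^sub>1, \<dots>, b\<^sub>r\<close>: by Ramsey's theorem there are many blocks of
  \<open>r\<close> indices whose translates of \<open>A\<^sub>1\<close> are pairwise almost independent, and the inequality makes
  one of them almost independent of \<open>A\<^sub>0\<close>. For one summand the property forbids infinitely many
  bad group elements, which is mixing.
\<close>

section \<open>Almost pairwise independent events\<close>

text \<open>
  Cauchy--Schwarz against \<open>F = \<Sum>\<^sub>i \<sigma>\<^sub>i (1\<^bsub>W\<^sub>i\<^esub> - c)\<close>, where \<open>\<sigma>\<^sub>i\<close> is the sign of the \<open>i\<close>-th correlation,
  bounds the sum by the square root of \<open>E F\<^sup>2 \<le> N + 3 \<delta> N\<^sup>2\<close>, where \<open>N = card J\<close> and the term \<open>N\<close>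
  comes from the diagonal. For \<open>\<delta> = \<epsilon>\<^sup>2 / 6\<close> and \<open>N \<ge> 2 / \<epsilon>\<^sup>2\<close> both terms are at most \<open>(\<epsilon> N)\<^sup>2 / 2\<close>.
\<close>

lemma (in prob_space) sum_abs_correlation_le:
  fixes W :: "'i \<Rightarrow> 'a set" and \<delta> \<epsilon> c :: real
  assumes J: "finite J" and W: "\<And>i. i \<in> J \<Longrightarrow> W i \<in> events" and B: "B \<in> events"
    and c: "0 \<le> c" "c \<le> 1" and \<delta>: "\<delta> = \<epsilon>\<^sup>2 / 6" and \<epsilon>: "0 < \<epsilon>"
    and N: "2 \<le> \<epsilon>\<^sup>2 * card J"
    and single: "\<And>i. i \<in> J \<Longrightarrow> \<bar>prob (W i) - c\<bar> \<le> \<delta>"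
    and pair: "\<And>i j. i \<in> J \<Longrightarrow> j \<in> J \<Longrightarrow> i \<noteq> j \<Longrightarrow> \<bar>prob (W i \<inter> W j) - c\<^sup>2\<bar> \<le> \<delta>"
  shows "(\<Sum>i\<in>J. \<bar>prob (B \<inter> W i) - c * prob B\<bar>) \<le> \<epsilon> * card J"
proof -
  define \<sigma> where "\<sigma> i = sgn (prob (B \<inter> W i) - c * prob B)" for i
  define w where "w i x = indicator (W i) x - c" for i x
  define F where "F x = (\<Sum>i\<in>J. \<sigma> i * w i x)" for x
  have \<sigma>1: "\<bar>\<sigma> i\<bar> \<le> 1" for i
    by (simp add: \<sigma>_def abs_sgn_eq)
  have w1: "\<bar>w i x\<bar> \<le> 1" for i x
    using c by (auto simp: w_def indicator_def)
  have ww1: "\<bar>w i x\<bar> * \<bar>w j x\<bar> \<le> 1" for i j x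
    using w1 by (intro mult_le_one) auto
  have wm [measurable]: "w i \<in> borel_measurable M" if "i \<in> J" for i
    using W[OF that] unfolding w_def by measurable
  have Fm [measurable]: "F \<in> borel_measurable M"
    unfolding F_def by measurable
  have F_bound: "\<bar>F x\<bar> \<le> card J" for x
  proof -
    have "\<bar>F x\<bar> \<le> (\<Sum>i\<in>J. \<bar>\<sigma> i * w i x\<bar>)"
      unfolding F_def by (rule sum_abs)
    also have "\<dots> \<le> (\<Sum>i\<in>J. 1)"
      by (intro sum_mono) (use \<sigma>1 w1 in \<open>auto simp: abs_mult intro: mult_le_one\<close>)
    finally show ?thesis by simp
  qed
  define BF where "BF x = indicator B x * F x" for x
  have BFm [measurable]: "BF \<in> borel_measurable M"
    unfolding BF_def using B by measurable
  have BF_bound: "\<bar>BF x\<bar> \<le> card J" for x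
    using F_bound[of x] by (auto simp: BF_def indicator_def)
  have int_BF: "integrable M BF"
    by (rule integrable_const_bound[where B = "card J"]) (use BF_bound in auto)
  have sq: "y\<^sup>2 \<le> (card J)\<^sup>2" if "\<bar>y\<bar> \<le> card J" for y :: real
    using power_mono[OF that, of 2] by simp
  have int_BF2: "integrable M (\<lambda>x. (BF x)\<^sup>2)"
    by (rule integrable_const_bound[where B = "(card J)\<^sup>2"]) (use sq[OF BF_bound] in auto)
  have int_F2: "integrable M (\<lambda>x. (F x)\<^sup>2)"
    by (rule integrable_const_bound[where B = "(card J)\<^sup>2"]) (use sq[OF F_bound] in auto)
  have int_ww: "integrable M (\<lambda>x. w i x * w j x)" if "i \<in> J" "j \<in> J" for i j
    by (rule integrable_const_bound[where B = 1])
      (use ww1 that in \<open>auto simp: abs_mult\<close>)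
  have int_ind: "integrable M (indicator A :: _ \<Rightarrow> real)" if "A \<in> events" for A
    by (rule integrable_const_bound[where B = 1]) (use that in \<open>auto simp: indicator_def\<close>)
  have int_id: "expectation (indicator A) = prob A" if "A \<in> events" for A
    using that by (simp add: Int_absorb2 sets.sets_into_space)
  have "(\<Sum>i\<in>J. \<bar>prob (B \<inter> W i) - c * prob B\<bar>) = (\<Sum>i\<in>J. \<sigma> i * (prob (B \<inter> W i) - c * prob B))"
    by (simp add: \<sigma>_def abs_sgn mult.commute)
  also have "\<dots> = (\<Sum>i\<in>J. \<integral>x. \<sigma> i * (indicator (B \<inter> W i) x - c * indicator B x) \<partial>M)"
  proof (intro sum.cong refl)
    fix i assume "i \<in> J"
    then have ev: "B \<inter> W i \<in> events" using W B by auto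
    show "\<sigma> i * (prob (B \<inter> W i) - c * prob B)
        = (\<integral>x. \<sigma> i * (indicator (B \<inter> W i) x - c * indicator B x) \<partial>M)"
      using int_ind[OF ev] int_ind[OF B] by (simp add: int_id[OF ev] int_id[OF B] del: Bochner_Integration.integral_indicator)
  qed
  also have "\<dots> = (\<integral>x. BF x \<partial>M)"
  proof (subst Bochner_Integration.integral_sum[symmetric])
    show "integrable M (\<lambda>x. \<sigma> i * (indicator (B \<inter> W i) x - c * indicator B x))" if "i \<in> J" for i
      using int_ind W B that by (intro integrable_mult_right Bochner_Integration.integrable_diff) auto
    have "(\<Sum>i\<in>J. \<sigma> i * (indicator (B \<inter> W i) x - c * indicator B x)) = BF x" for x
      unfolding BF_def F_def w_def sum_distrib_left
      by (intro sum.cong) (auto simp: indicator_def)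
    then show "(\<integral>x. (\<Sum>i\<in>J. \<sigma> i * (indicator (B \<inter> W i) x - c * indicator B x)) \<partial>M) = (\<integral>x. BF x \<partial>M)"
      by simp
  qed
  finally have sum_eq: "(\<Sum>i\<in>J. \<bar>prob (B \<inter> W i) - c * prob B\<bar>) = expectation BF" .
  \<comment> \<open>Cauchy--Schwarz, as non-negativity of the variance of the product of \<open>F\<close> with the indicator of \<open>B\<close>\<close>
  have "(expectation BF)\<^sup>2 \<le> expectation (\<lambda>x. (BF x)\<^sup>2)"
    using variance_positive[of BF] variance_eq[OF int_BF int_BF2] by simp
  also have "\<dots> \<le> expectation (\<lambda>x. (F x)\<^sup>2)"
    by (intro integral_mono int_BF2 int_F2) (auto simp: BF_def indicator_def)
  also have "\<dots> = expectation (\<lambda>x. \<Sum>i\<in>J. \<Sum>j\<in>J. \<sigma> i * \<sigma> j * (w i x * w j x))"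
    unfolding F_def power2_eq_square sum_product by (simp add: ac_simps)
  also have "\<dots> = (\<Sum>i\<in>J. \<Sum>j\<in>J. \<sigma> i * \<sigma> j * expectation (\<lambda>x. w i x * w j x))"
    using int_ww by (simp add: Bochner_Integration.integral_sum Bochner_Integration.integrable_sum)
  also have "\<dots> \<le> (\<Sum>i\<in>J. \<Sum>j\<in>J. (if i = j then 1 else 0) + 3 * \<delta>)"
  proof (intro sum_mono)
    fix i j assume ij: "i \<in> J" "j \<in> J"
    have \<delta>0: "0 \<le> \<delta>" unfolding \<delta> by simp
    have "\<bar>expectation (\<lambda>x. w i x * w j x)\<bar> \<le> (if i = j then 1 else 0) + 3 * \<delta>"
    proof (cases "i = j")
      case True
      have "\<bar>expectation (\<lambda>x. w i x * w j x)\<bar> \<le> expectation (\<lambda>x. \<bar>w i x * w j x\<bar>)"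
        by (rule integral_abs_bound)
      also have "\<dots> \<le> expectation (\<lambda>x. 1)"
        by (intro integral_mono integrable_abs int_ww ij)
          (use ww1 in \<open>auto simp: abs_mult\<close>)
      finally show ?thesis using True \<delta>0 by (simp add: prob_space)
    next
      case False
      have ev: "W i \<inter> W j \<in> events" "W i \<in> events" "W j \<in> events"
        using W ij by auto
      have "(\<lambda>x. w i x * w j x) = (\<lambda>x. indicator (W i \<inter> W j) x - c * indicator (W i) x - c * indicator (W j) x + c\<^sup>2)"
        by (auto simp: w_def indicator_def power2_eq_square algebra_simps)
      then have "expectation (\<lambda>x. w i x * w j x) = prob (W i \<inter> W j) - c * prob (W i) - c * prob (W j) + c\<^sup>2"
        using ev[THEN int_ind] by (simp add: prob_space ev[THEN int_id] del: Bochner_Integration.integral_indicator)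
      also have "\<dots> = (prob (W i \<inter> W j) - c\<^sup>2) - c * (prob (W i) - c) - c * (prob (W j) - c)"
        by (simp add: algebra_simps power2_eq_square)
      also have "\<bar>\<dots>\<bar> \<le> \<bar>prob (W i \<inter> W j) - c\<^sup>2\<bar> + \<bar>c * (prob (W i) - c)\<bar> + \<bar>c * (prob (W j) - c)\<bar>"
        by linarith
      also have "\<dots> \<le> \<delta> + \<delta> + \<delta>"
      proof (intro add_mono)
        have "\<bar>c * (prob (W k) - c)\<bar> \<le> \<delta>" if "k \<in> J" for k
          using mult_mono[OF c(2) single[OF that]] c by (simp add: abs_mult)
        then show "\<bar>c * (prob (W i) - c)\<bar> \<le> \<delta>" "\<bar>c * (prob (W j) - c)\<bar> \<le> \<delta>"
          using ij by auto
      qed (use pair ij False in auto)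
      finally show ?thesis using False by simp
    qed
    moreover have "\<sigma> i * \<sigma> j * expectation (\<lambda>x. w i x * w j x) \<le> 1 * \<bar>expectation (\<lambda>x. w i x * w j x)\<bar>"
    proof -
      have "\<bar>\<sigma> i * \<sigma> j\<bar> \<le> 1" using \<sigma>1 by (auto simp: abs_mult intro: mult_le_one)
      then have "\<bar>\<sigma> i * \<sigma> j * expectation (\<lambda>x. w i x * w j x)\<bar> \<le> 1 * \<bar>expectation (\<lambda>x. w i x * w j x)\<bar>"
        unfolding abs_mult[of "\<sigma> i * \<sigma> j"] by (rule mult_right_mono) simp
      then show ?thesis by linarith
    qed
    ultimately show "\<sigma> i * \<sigma> j * expectation (\<lambda>x. w i x * w j x) \<le> (if i = j then 1 else 0) + 3 * \<delta>"
      by linarith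
  qed
  also have "\<dots> = card J + 3 * \<delta> * (card J)\<^sup>2"
    using J by (simp add: sum.distrib power2_eq_square algebra_simps)
  also have "\<dots> \<le> (\<epsilon> * card J)\<^sup>2"
    using mult_right_mono[OF N, of "card J"] by (simp add: \<delta> power2_eq_square algebra_simps)
  finally have "expectation BF \<le> \<epsilon> * card J"
    by (rule power2_le_imp_le) (use \<epsilon> in simp)
  then show ?thesis using sum_eq by simp
qed

section \<open>Sequences tending to infinity\<close>

text \<open>
  Each new index is taken so late that the relation holds between all earlier indices and it.
\<close>

lemma ex_finite_pairwise_eventually:
  fixes Q :: "nat \<Rightarrow> nat \<Rightarrow> bool"
  assumes "\<And>k. eventually (Q k) sequentially"
  shows "\<exists>J. finite J \<and> card J = N \<and> (\<forall>k\<in>J. K < k) \<and> (\<forall>i\<in>J. \<forall>j\<in>J. i < j \<longrightarrow> Q i j)"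
proof (induction N)
  case 0
  show ?case by (rule exI[of _ "{}"]) simp
next
  case (Suc N)
  then obtain J where J: "finite J" "card J = N" "\<forall>k\<in>J. K < k" "\<forall>i\<in>J. \<forall>j\<in>J. i < j \<longrightarrow> Q i j"
    by blast
  have "eventually (\<lambda>k. (\<forall>i\<in>J. Q i k) \<and> Max (insert K J) < k) sequentially"
    using assms J(1) by (auto simp: eventually_conj_iff intro!: eventually_ball_finite eventually_gt_at_top)
  then obtain k where k: "\<forall>i\<in>J. Q i k" "Max (insert K J) < k"
    by (auto dest: eventually_happens)
  then have less: "K < k" "\<forall>i\<in>J. i < k"
    using J(1) by simp_all
  then have "k \<notin> J" "\<forall>j\<in>J. \<not> k < j" by (blast dest: less_asym)+
  have "finite (insert k J)" "card (insert k J) = Suc N"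
    using J(1,2) \<open>k \<notin> J\<close> by simp_all
  moreover have "\<forall>j\<in>insert k J. K < j"
    using J(3) less(1) by blast
  moreover have "\<forall>i\<in>insert k J. \<forall>j\<in>insert k J. i < j \<longrightarrow> Q i j"
    using J(4) k(1) \<open>\<forall>j\<in>J. \<not> k < j\<close> by blast
  ultimately show ?case by blast
qed

lemma filterlim_uminus_cofinite:
  fixes b :: "'b \<Rightarrow> 'h::group_add"
  assumes "filterlim b cofinite F"
  shows "filterlim (\<lambda>k. - b k) cofinite F"
proof -
  have "filterlim (uminus :: 'h \<Rightarrow> 'h) cofinite cofinite"
    unfolding filterlim_iff eventually_cofinite
  proof (intro allI impI)
    fix P :: "'h \<Rightarrow> bool" assume "finite {x. \<not> P x}"
    then have "finite (uminus ` {x. \<not> P x})" by simp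
    also have "uminus ` {x. \<not> P x} = {x. \<not> P (- x)}" by (force simp: image_iff)
    finally show "finite {x. \<not> P (- x)}" .
  qed
  from filterlim_compose[OF this assms] show ?thesis .
qed

lemma filterlim_inj_cofinite:
  fixes b :: "nat \<Rightarrow> 'h"
  assumes "inj b"
  shows "filterlim b cofinite sequentially"
  unfolding filterlim_iff eventually_cofinite cofinite_eq_sequentially[symmetric]
proof (intro allI impI)
  fix P :: "'h \<Rightarrow> bool" assume "finite {x. \<not> P x}"
  from finite_vimageI[OF this assms] show "finite {k. \<not> P (b k)}"
    by (simp add: vimage_def)
qed

text \<open>
  Avoid at step \<open>k\<close> the first \<open>k\<close> elements of the group and their translates by \<open>h t k\<close>: these are
  finitely many.
\<close>

lemma ex_generic_sequence:
  fixes h :: "nat \<Rightarrow> nat \<Rightarrow> 'h::{ab_group_add,countable}"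
  assumes "infinite (UNIV :: 'h set)"
  shows "\<exists>c. filterlim c cofinite sequentially \<and>
    (\<forall>t\<in>{1..d}. filterlim (\<lambda>k. c k - h t k) cofinite sequentially)"
proof -
  define F where "F k = {x :: 'h. to_nat x \<le> k}" for k
  have F: "finite (F k)" for k
    using finite_vimageI[of "{..k}" to_nat] by (simp add: F_def vimage_def inj_to_nat)
  have "\<exists>x. x \<notin> F k \<union> (\<Union>t\<in>{1..d}. (\<lambda>y. y + h t k) ` F k)" for k
    by (intro ex_new_if_finite assms) (use F in auto)
  then obtain c where c: "\<And>k. c k \<notin> F k \<union> (\<Union>t\<in>{1..d}. (\<lambda>y. y + h t k) ` F k)" by metis
  have to_inf: "filterlim f cofinite sequentially" if "\<And>k. f k \<notin> F k" for f :: "nat \<Rightarrow> 'h"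
  proof -
    have ev: "eventually (\<lambda>k. f k \<noteq> x) sequentially" for x
      using that by (auto simp: F_def not_le intro!: eventually_sequentiallyI[of "to_nat x"])
        (metis not_le)
    have "eventually (\<lambda>k. P (f k)) sequentially" if P: "finite {x. \<not> P x}" for P
    proof -
      have "eventually (\<lambda>k. \<forall>x\<in>{x. \<not> P x}. f k \<noteq> x) sequentially"
        by (rule eventually_ball_finite[OF P]) (use ev in blast)
      then show ?thesis by (rule eventually_mono) blast
    qed
    then show ?thesis
      unfolding filterlim_iff eventually_cofinite by blast
  qed
  have "c k - h t k \<notin> F k" if "t \<in> {1..d}" for t k
    using c[of k] that by (force simp: image_iff algebra_simps)
  then show ?thesis
    using c by (intro exI[of _ c]) (auto intro!: to_inf)
qed

text \<open>
  Any sequence tending to infinity occurs as the first coordinate of a sequence of tuples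
  admissible in a \<^const>\<open>Sigma_tilde_set\<close>: the other coordinates are chosen one after another.
\<close>

lemma ex_generic_tuple_sequence:
  fixes b :: "nat \<Rightarrow> 'h::{ab_group_add,countable}" and d :: nat
  assumes b: "filterlim b cofinite sequentially"
  shows "\<exists>h. h 1 = b \<and> (\<forall>t\<in>{1..d}. filterlim (h t) cofinite sequentially) \<and>
    (\<forall>t\<in>{1..d}. \<forall>t'\<in>{1..d}. t \<noteq> t' \<longrightarrow> filterlim (\<lambda>k. h t k - h t' k) cofinite sequentially)"
proof (induction d)
  case (Suc d)
  then obtain h where h: "h 1 = b" "\<forall>t\<in>{1..d}. filterlim (h t) cofinite sequentially"
    "\<forall>t\<in>{1..d}. \<forall>t'\<in>{1..d}. t \<noteq> t' \<longrightarrow> filterlim (\<lambda>k. h t k - h t' k) cofinite sequentially"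
    by blast
  have inf: "infinite (UNIV :: 'h set)"
  proof
    assume "finite (UNIV :: 'h set)"
    then have "eventually (\<lambda>x :: 'h. False) cofinite" by (simp add: eventually_cofinite)
    from eventually_compose_filterlim[OF this b] show False by simp
  qed
  show ?case
  proof (cases "d = 0")
    case True
    then show ?thesis using b by (intro exI[of _ "\<lambda>_. b"]) auto
  next
    case False
    obtain c where c: "filterlim c cofinite sequentially"
      "\<forall>t\<in>{1..d}. filterlim (\<lambda>k. c k - h t k) cofinite sequentially"
      using ex_generic_sequence[OF inf, of d h] by blast
    have c': "filterlim (\<lambda>k. h t k - c k) cofinite sequentially" if "t \<in> {1..d}" for t
      using filterlim_uminus_cofinite c(2)[rule_format, OF that] by fastforce
    show ?thesis
      using h c c' False by (intro exI[of _ "h(Suc d := c)"]) (auto simp: le_Suc_eq)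
  qed
qed (use b in auto)

section \<open>The action on measurable sets\<close>

context measure_preserving_system
begin

lemma space_UNIV: "space M = UNIV"
  using sets_eq_imp_space_eq[OF sets_borel] by simp

lemma act_cancel [simp]: "T (- g) (T g x) = x" "T g (T (- g) x) = x"
  using act_add[of "- g" g] act_add[of g "- g"] act_zero by (auto simp: fun_eq_iff)

lemma inj_act: "inj (T g)"
  by (metis act_cancel(1) injI)

lemma act_image_add: "T (g + h) ` A = T g ` T h ` A"
  by (simp add: act_add image_comp)

lemma act_image_eq_vimage: "T g ` A = T (- g) -` A"
  by (auto simp: image_iff) (metis act_cancel(2))

lemma sets_act_image [measurable]: "A \<in> events \<Longrightarrow> T g ` A \<in> events"
  using measurable_sets[OF measurable_act] by (auto simp: act_image_eq_vimage space_UNIV)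

lemma prob_act_image [simp]: "A \<in> events \<Longrightarrow> prob (T g ` A) = prob A"
  using measure_distr[OF measurable_act, of A "- g"]
  by (simp add: act_image_eq_vimage space_UNIV distr_act)

lemma prob_Int_act_image:
  assumes "A \<in> events" "B \<in> events"
  shows "prob (T h ` A \<inter> T (h + g) ` B) = prob (A \<inter> T g ` B)"
  using prob_act_image[of "A \<inter> T g ` B" h] assms
  by (simp add: image_Int[OF inj_act] act_image_add)

section \<open>Strong mixing implies mixing along sums\<close>

text \<open>
  For \<open>m\<close> levels of sequences, any \<open>m + 1\<close> coordinates are almost independent along some sum. The
  quantification over finite collections \<open>\<Phi>\<close>, all served by one choice of indices, and over
  the lower bound \<open>K\<close> for the indices is what makes the induction on \<open>m\<close> work.
\<close>

definition independent_along :: "'i set \<Rightarrow> (nat \<Rightarrow> 'i \<Rightarrow> 'g) list \<Rightarrow> bool" where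
  "independent_along I as \<longleftrightarrow>
    (\<forall>\<Phi> K \<epsilon>. finite \<Phi> \<longrightarrow>
      (\<forall>S A. (S, A) \<in> \<Phi> \<longrightarrow> S \<subseteq> I \<and> card S = Suc (length as) \<and> (\<forall>t\<in>S. A t \<in> events)) \<longrightarrow> 0 < \<epsilon> \<longrightarrow>
      (\<exists>ks. length ks = length as \<and> sorted_wrt (<) (K # ks) \<and>
        (\<forall>(S, A)\<in>\<Phi>. \<bar>prob (\<Inter>t\<in>S. T (\<Sum>(a, k)\<leftarrow>zip as ks. a k t) ` A t) - (\<Prod>t\<in>S. prob (A t))\<bar> < \<epsilon>)))"

lemma independent_alongD:
  assumes "independent_along I as" "finite \<Phi>"
    "\<And>S A. (S, A) \<in> \<Phi> \<Longrightarrow> S \<subseteq> I \<and> card S = Suc (length as) \<and> (\<forall>t\<in>S. A t \<in> events)" "0 < \<epsilon>"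
  shows "\<exists>ks. length ks = length as \<and> sorted_wrt (<) (K # ks) \<and>
        (\<forall>(S, A)\<in>\<Phi>. \<bar>prob (\<Inter>t\<in>S. T (\<Sum>(a, k)\<leftarrow>zip as ks. a k t) ` A t) - (\<Prod>t\<in>S. prob (A t))\<bar> < \<epsilon>)"
  using assms(2-) by (intro assms(1)[unfolded independent_along_def, THEN spec, THEN spec, THEN spec, THEN mp, THEN mp, THEN mp]) auto

lemma independent_along_Nil: "independent_along (I :: 'i set) []"
  unfolding independent_along_def
proof (intro allI impI)
  fix \<Phi> :: "('i set \<times> ('i \<Rightarrow> 'x set)) set" and K :: nat and \<epsilon> :: real
  assume fam: "\<forall>S A. (S, A) \<in> \<Phi> \<longrightarrow> S \<subseteq> I \<and> card S = Suc (length []) \<and> (\<forall>t\<in>S. A t \<in> events)"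
    and \<epsilon>: "0 < \<epsilon>"
  have "\<bar>prob (\<Inter>t\<in>S. T 0 ` A t) - (\<Prod>t\<in>S. prob (A t))\<bar> < \<epsilon>" if SA: "(S, A) \<in> \<Phi>" for S A
  proof -
    have "card S = 1" using fam SA by auto
    then obtain t where "S = {t}" by (rule card_1_singletonE)
    then show ?thesis using \<epsilon> by (simp add: act_zero)
  qed
  then show "\<exists>ks. length ks = length [] \<and> sorted_wrt (<) (K # ks) \<and>
      (\<forall>(S, A)\<in>\<Phi>. \<bar>prob (\<Inter>t\<in>S. T (\<Sum>(a, k)\<leftarrow>zip [] ks. a k t) ` A t) - (\<Prod>t\<in>S. prob (A t))\<bar> < \<epsilon>)"
    by (intro exI[of _ "[]"]) auto
qed

text \<open>
  The inner indices \<open>ks\<close> are chosen after a finite set \<open>J\<close> of candidates for the outer index is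
  fixed, and the outer index is then picked from \<open>J\<close> by averaging.
\<close>

lemma independent_along_Cons:
  fixes a :: "nat \<Rightarrow> 'i \<Rightarrow> 'g"
  assumes mixing: "strongly_mixing M T" and IH: "independent_along I as"
    and a: "\<And>t t'. t \<in> I \<Longrightarrow> t' \<in> I \<Longrightarrow> t \<noteq> t' \<Longrightarrow> filterlim (\<lambda>k. a k t - a k t') cofinite sequentially"
  shows "independent_along I (a # as)"
  unfolding independent_along_def
proof (intro allI impI)
  fix \<Phi> :: "('i set \<times> ('i \<Rightarrow> 'x set)) set" and K :: nat and \<epsilon> :: real
  assume fin: "finite \<Phi>" and \<epsilon>: "0 < \<epsilon>"
    and "\<forall>S A. (S, A) \<in> \<Phi> \<longrightarrow> S \<subseteq> I \<and> card S = Suc (length (a # as)) \<and> (\<forall>t\<in>S. A t \<in> events)"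
  then have fam: "S \<subseteq> I" "card S = Suc (Suc (length as))" "\<forall>t\<in>S. A t \<in> events" if "(S, A) \<in> \<Phi>" for S A
    using that by auto
  define s where "s S = (SOME t. t \<in> S)" for S :: "'i set"
  define S' where "S' S = S - {s S}" for S
  \<comment> \<open>shifts relative to the coordinate \<open>s S\<close>, which then stays in place\<close>
  define B where "B S A k t = T (a k t - a k (s S)) ` A t" for S :: "'i set" and A k t
  define c where "c S A = (\<Prod>t\<in>S' S. prob (A t))" for S A
  have \<Phi>: "finite S" "S \<subseteq> I" "s S \<in> S" "S' S \<subseteq> S" "finite (S' S)" "card (S' S) = Suc (length as)"
      "s S \<notin> S' S" "\<And>t. t \<in> S \<Longrightarrow> A t \<in> events" if "(S, A) \<in> \<Phi>" for S A
  proof -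
    have S: "S \<subseteq> I" "card S = Suc (Suc (length as))" "\<forall>t\<in>S. A t \<in> events"
      using fam[OF that] by auto
    have "finite S" using S(2) by (intro card_ge_0_finite) simp
    moreover have "S \<noteq> {}" using S(2) by auto
    then have "s S \<in> S" unfolding s_def by (simp add: some_in_eq)
    ultimately show "finite S" "S \<subseteq> I" "s S \<in> S" "S' S \<subseteq> S" "finite (S' S)" "card (S' S) = Suc (length as)"
      "s S \<notin> S' S" "\<And>t. t \<in> S \<Longrightarrow> A t \<in> events"
      using S by (auto simp: S'_def)
  qed
  have Bm: "B S A k t \<in> events" if "(S, A) \<in> \<Phi>" "t \<in> S" for S A k t
    unfolding B_def using \<Phi>(8)[OF that] by simp
  \<comment> \<open>average error per member of \<open>\<Phi>\<close>, so that the errors of all members add up to less than \<open>\<epsilon>\<close>\<close>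
  define \<eta> where "\<eta> = \<epsilon> / (card \<Phi> + 1)"
  have \<eta>: "0 < \<eta>" using \<epsilon> by (simp add: \<eta>_def add_nonneg_pos)
  define \<delta> where "\<delta> = \<eta>\<^sup>2 / 6"
  have \<delta>: "0 < \<delta>" using \<eta> by (simp add: \<delta>_def)
  define Q where "Q k k' \<longleftrightarrow> (\<forall>(S, A)\<in>\<Phi>. \<bar>(\<Prod>t\<in>S' S. prob (B S A k t \<inter> B S A k' t)) - (c S A)\<^sup>2\<bar> < \<delta> / 2)"
    for k k'
  have "eventually (Q k) sequentially" for k
  proof -
    have "eventually (\<lambda>k'. \<bar>(\<Prod>t\<in>S' S. prob (B S A k t \<inter> B S A k' t)) - (c S A)\<^sup>2\<bar> < \<delta> / 2) sequentially"
      if SA: "(S, A) \<in> \<Phi>" for S A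
    proof -
      have "((\<lambda>k'. prob (B S A k t \<inter> B S A k' t)) \<longlongrightarrow> prob (A t) * prob (A t)) sequentially"
        if t: "t \<in> S' S" for t
      proof -
        have tS: "t \<in> S" "t \<noteq> s S" using t by (auto simp: S'_def)
        have ev: "B S A k t \<in> events" "A t \<in> events"
          using Bm[OF SA tS(1)] \<Phi>(8)[OF SA tS(1)] by auto
        have "((\<lambda>g. prob (B S A k t \<inter> T g ` A t)) \<longlongrightarrow> prob (B S A k t) * prob (A t)) cofinite"
          using mixing ev unfolding strongly_mixing_def by blast
        moreover have "filterlim (\<lambda>k'. a k' t - a k' (s S)) cofinite sequentially"
          using a[of t "s S"] \<Phi>(2,3)[OF SA] tS by auto
        ultimately have "((\<lambda>k'. prob (B S A k t \<inter> T (a k' t - a k' (s S)) ` A t)) \<longlongrightarrow> prob (B S A k t) * prob (A t)) sequentially"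
          by (rule filterlim_compose)
        moreover have "prob (B S A k t) = prob (A t)"
          unfolding B_def using ev by simp
        ultimately show ?thesis by (simp add: B_def)
      qed
      then have "((\<lambda>k'. \<Prod>t\<in>S' S. prob (B S A k t \<inter> B S A k' t)) \<longlongrightarrow> (\<Prod>t\<in>S' S. prob (A t) * prob (A t))) sequentially"
        by (rule tendsto_prod)
      then have "((\<lambda>k'. \<Prod>t\<in>S' S. prob (B S A k t \<inter> B S A k' t)) \<longlongrightarrow> (c S A)\<^sup>2) sequentially"
        by (simp add: c_def prod.distrib power2_eq_square)
      from tendstoD[OF this, of "\<delta> / 2"] \<delta> show ?thesis by (simp add: dist_real_def)
    qed
    then show ?thesis
      unfolding Q_def using fin by (auto intro!: eventually_ball_finite)
  qed
  \<comment> \<open>enough candidates for the averaging inequality with error \<open>\<eta>\<close>\<close>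
  define N where "N = nat \<lceil>2 / \<eta>\<^sup>2\<rceil> + 1"
  from ex_finite_pairwise_eventually[of Q N K, OF \<open>\<And>k. eventually (Q k) sequentially\<close>]
  obtain J where J: "finite J" "card J = N" "\<forall>k\<in>J. K < k" "\<forall>i\<in>J. \<forall>j\<in>J. i < j \<longrightarrow> Q i j"
    by blast
  have "2 / \<eta>\<^sup>2 \<le> real N" unfolding N_def by linarith
  then have N: "2 \<le> \<eta>\<^sup>2 * card J" using \<eta> J(2) by (simp add: field_simps)
  have J_ne: "J \<noteq> {}" "0 < card J" using J(1,2) by (auto simp: N_def)
  have Q_sym: "Q i j" if "i \<in> J" "j \<in> J" "i \<noteq> j" for i j
  proof (cases "i < j")
    case False
    then have "Q j i" using J(4) that by auto
    then show ?thesis unfolding Q_def by (simp add: Int_commute)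
  qed (use J(4) that in auto)
  \<comment> \<open>The case \<open>i = j\<close> is included: it controls the probability of a single \<open>W\<close>.\<close>
  define \<Psi> where "\<Psi> = (\<lambda>((S, A), i, j). (S' S, \<lambda>t. B S A i t \<inter> B S A j t)) ` (\<Phi> \<times> J \<times> J)"
  have "finite \<Psi>" unfolding \<Psi>_def using J fin by auto
  moreover have "S \<subseteq> I \<and> card S = Suc (length as) \<and> (\<forall>t\<in>S. A t \<in> events)" if SA: "(S, A) \<in> \<Psi>" for S A
  proof -
    obtain S\<^sub>0 A\<^sub>0 i j where eq: "(S\<^sub>0, A\<^sub>0) \<in> \<Phi>" "S = S' S\<^sub>0" "A = (\<lambda>t. B S\<^sub>0 A\<^sub>0 i t \<inter> B S\<^sub>0 A\<^sub>0 j t)"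
      using SA unfolding \<Psi>_def by auto
    show ?thesis
      using \<Phi>(2,4,6)[OF eq(1)] Bm[OF eq(1)] unfolding eq(2,3) by auto
  qed
  moreover have "0 < \<delta> / 2" using \<delta> by simp
  ultimately have "\<exists>ks. length ks = length as \<and> sorted_wrt (<) (Max J # ks) \<and>
      (\<forall>(S, A)\<in>\<Psi>. \<bar>prob (\<Inter>t\<in>S. T (\<Sum>(a, k)\<leftarrow>zip as ks. a k t) ` A t) - (\<Prod>t\<in>S. prob (A t))\<bar> < \<delta> / 2)"
    by (rule independent_alongD[OF IH])
  then obtain ks where ks: "length ks = length as" "sorted_wrt (<) (Max J # ks)"
    and "\<forall>(S, A)\<in>\<Psi>. \<bar>prob (\<Inter>t\<in>S. T (\<Sum>(a, k)\<leftarrow>zip as ks. a k t) ` A t) - (\<Prod>t\<in>S. prob (A t))\<bar> < \<delta> / 2"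
    by blast
  then have close: "\<And>S A i j. (S, A) \<in> \<Phi> \<Longrightarrow> i \<in> J \<Longrightarrow> j \<in> J \<Longrightarrow>
      \<bar>prob (\<Inter>t\<in>S' S. T (\<Sum>(a, k)\<leftarrow>zip as ks. a k t) ` (B S A i t \<inter> B S A j t))
        - (\<Prod>t\<in>S' S. prob (B S A i t \<inter> B S A j t))\<bar> < \<delta> / 2"
    unfolding \<Psi>_def by (force simp: ball_simps)
  define u where "u t = (\<Sum>(a, k)\<leftarrow>zip as ks. a k t)" for t
  define W where "W S A i = (\<Inter>t\<in>S' S. T (u t) ` B S A i t)" for S A i
  define err where "err S A i = \<bar>prob (T (u (s S)) ` A (s S) \<inter> W S A i) - c S A * prob (A (s S))\<bar>" for S A i
  have S'_ne: "S' S \<noteq> {}" if "(S, A) \<in> \<Phi>" for S A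
    using \<Phi>(6)[OF that] by auto
  have avg: "(\<Sum>i\<in>J. err S A i) \<le> \<eta> * card J" if SA: "(S, A) \<in> \<Phi>" for S A
  proof -
    have Wm: "W S A i \<in> events" for i
      unfolding W_def using \<Phi>[OF SA] S'_ne[OF SA] Bm[OF SA] by (intro sets.finite_INT) auto
    have WInt: "W S A i \<inter> W S A j = (\<Inter>t\<in>S' S. T (u t) ` (B S A i t \<inter> B S A j t))" for i j
      unfolding W_def by (auto simp: image_Int[OF inj_act])
    have c01: "0 \<le> c S A" "c S A \<le> 1"
      unfolding c_def by (auto intro!: prod_nonneg prod_le_1)
    have probB: "prob (B S A i t) = prob (A t)" if "t \<in> S' S" for i t
      unfolding B_def using \<Phi>(8)[OF SA] \<Phi>(4)[OF SA] that by auto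
    have "(\<Sum>i\<in>J. \<bar>prob (T (u (s S)) ` A (s S) \<inter> W S A i) - c S A * prob (T (u (s S)) ` A (s S))\<bar>) \<le> \<eta> * card J"
    proof (rule sum_abs_correlation_le[OF J(1) Wm _ c01 \<delta>_def \<eta> N])
      show "T (u (s S)) ` A (s S) \<in> events" using \<Phi>(3,8)[OF SA] by simp
      show "\<bar>prob (W S A i) - c S A\<bar> \<le> \<delta>" if i: "i \<in> J" for i
        using close[OF SA i i] WInt[of i i] probB \<delta> by (simp add: u_def[symmetric] c_def)
      show "\<bar>prob (W S A i \<inter> W S A j) - (c S A)\<^sup>2\<bar> \<le> \<delta>" if ij: "i \<in> J" "j \<in> J" "i \<noteq> j" for i j
      proof -
        have "\<bar>(\<Prod>t\<in>S' S. prob (B S A i t \<inter> B S A j t)) - (c S A)\<^sup>2\<bar> < \<delta> / 2"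
          using Q_sym[OF ij] SA unfolding Q_def by auto
        then show ?thesis
          using close[OF SA ij(1,2)] unfolding WInt u_def[symmetric] by linarith
      qed
    qed
    then show ?thesis unfolding err_def using \<Phi>(3,8)[OF SA] by simp
  qed
  have "\<exists>i\<in>J. (\<Sum>(S, A)\<in>\<Phi>. err S A i) < \<epsilon>"
  proof (rule ccontr)
    assume "\<not> ?thesis"
    then have "(\<Sum>i\<in>J. \<epsilon>) \<le> (\<Sum>i\<in>J. \<Sum>(S, A)\<in>\<Phi>. err S A i)"
      by (intro sum_mono) auto
    also have "\<dots> = (\<Sum>(S, A)\<in>\<Phi>. \<Sum>i\<in>J. err S A i)"
      by (subst sum.swap) (simp add: case_prod_unfold)
    also have "\<dots> \<le> (\<Sum>(S, A)\<in>\<Phi>. \<eta> * card J)"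
      using avg by (intro sum_mono) auto
    finally have "\<epsilon> * card J \<le> card \<Phi> * \<eta> * card J" by (simp add: mult_ac)
    then have "\<epsilon> \<le> card \<Phi> * \<eta>" using J_ne(2) by simp
    then show False using \<epsilon> unfolding \<eta>_def by (simp add: field_simps)
  qed
  then obtain i where i: "i \<in> J" "(\<Sum>(S, A)\<in>\<Phi>. err S A i) < \<epsilon>" by blast
  have close_all: "\<bar>prob (\<Inter>t\<in>S. T (\<Sum>(a, k)\<leftarrow>zip (a # as) (i # ks). a k t) ` A t) - (\<Prod>t\<in>S. prob (A t))\<bar> < \<epsilon>"
    if SA: "(S, A) \<in> \<Phi>" for S A
  proof -
    have S: "S = insert (s S) (S' S)" using \<Phi>(3)[OF SA] by (auto simp: S'_def)
    \<comment> \<open>the common shift by \<open>a i (s S)\<close> preserves the measure and can be dropped\<close>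
    have tr: "T (a i t + u t) ` X = T (a i (s S)) ` T (u t) ` T (a i t - a i (s S)) ` X" for t X
      unfolding act_image_add[symmetric] by (simp add: algebra_simps)
    have "(\<Inter>t\<in>S. T (a i t + u t) ` A t) = T (a i (s S)) ` (T (u (s S)) ` A (s S) \<inter> W S A i)"
    proof -
      have "(\<Inter>t\<in>S. T (a i t + u t) ` A t) = T (a i (s S)) ` T (u (s S)) ` A (s S) \<inter> (\<Inter>t\<in>S' S. T (a i t + u t) ` A t)"
        by (subst S) (simp add: act_image_add)
      also have "(\<Inter>t\<in>S' S. T (a i t + u t) ` A t) = (\<Inter>t\<in>S' S. T (a i (s S)) ` T (u t) ` B S A i t)"
        unfolding B_def tr ..
      also have "\<dots> = T (a i (s S)) ` W S A i"
      proof -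
        obtain t where "t \<in> S' S" using S'_ne[OF SA] by blast
        then show ?thesis
          unfolding W_def by (intro image_INT[OF inj_act, symmetric]) auto
      qed
      finally show ?thesis by (simp add: image_Int[OF inj_act])
    qed
    moreover have "T (u (s S)) ` A (s S) \<inter> W S A i \<in> events"
      unfolding W_def using \<Phi>[OF SA] S'_ne[OF SA] Bm[OF SA] by (intro sets.Int sets.finite_INT) auto
    ultimately have "prob (\<Inter>t\<in>S. T (a i t + u t) ` A t) = prob (T (u (s S)) ` A (s S) \<inter> W S A i)"
      by simp
    moreover have "(\<Prod>t\<in>S. prob (A t)) = c S A * prob (A (s S))"
      unfolding c_def by (subst S) (use \<Phi>(5,7)[OF SA] in simp)
    ultimately have "\<bar>prob (\<Inter>t\<in>S. T (a i t + u t) ` A t) - (\<Prod>t\<in>S. prob (A t))\<bar> = err S A i"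
      by (simp add: err_def)
    also have "\<dots> \<le> (\<Sum>(S, A)\<in>\<Phi>. err S A i)"
      using member_le_sum[OF SA, of "\<lambda>(S, A). err S A i"] fin by (auto simp: err_def)
    finally show ?thesis using i(2) by (simp add: u_def)
  qed
  have all: "\<forall>(S, A)\<in>\<Phi>. \<bar>prob (\<Inter>t\<in>S. T (\<Sum>(a, k)\<leftarrow>zip (a # as) (i # ks). a k t) ` A t)
      - (\<Prod>t\<in>S. prob (A t))\<bar> < \<epsilon>"
    by (intro ballI case_prodI2) (rule close_all, simp only:)
  have sorted: "sorted_wrt (<) (K # i # ks)"
  proof -
    have "K < i" "i \<le> Max J" using i(1) J(1,3) by auto
    moreover have "\<forall>k\<in>set ks. Max J < k" "sorted_wrt (<) ks" using ks(2) by simp_all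
    ultimately have "\<forall>k\<in>set ks. i < k" by (meson le_less_trans)
    moreover from this have "\<forall>k\<in>set ks. K < k" using \<open>K < i\<close> less_trans by blast
    ultimately show ?thesis using \<open>K < i\<close> \<open>sorted_wrt (<) ks\<close> by simp
  qed
  have len: "length (i # ks) = length (a # as)"
    using ks(1) by simp
  show "\<exists>ks. length ks = length (a # as) \<and> sorted_wrt (<) (K # ks) \<and>
      (\<forall>(S, A)\<in>\<Phi>. \<bar>prob (\<Inter>t\<in>S. T (\<Sum>(a, k)\<leftarrow>zip (a # as) ks. a k t) ` A t) - (\<Prod>t\<in>S. prob (A t))\<bar> < \<epsilon>)"
    by (rule exI[of _ "i # ks"]) (rule conjI[OF len conjI[OF sorted all]])
qed

lemma independent_along_if_strongly_mixing:
  fixes as :: "(nat \<Rightarrow> 'i \<Rightarrow> 'g) list"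
  assumes "strongly_mixing M T"
    and "\<And>a t t'. a \<in> set as \<Longrightarrow> t \<in> I \<Longrightarrow> t' \<in> I \<Longrightarrow> t \<noteq> t' \<Longrightarrow>
          filterlim (\<lambda>k. a k t - a k t') cofinite sequentially"
  shows "independent_along I as"
  using assms(2)
proof (induction as)
  case Nil
  show ?case by (rule independent_along_Nil)
next
  case (Cons a as)
  show ?case
  proof (rule independent_along_Cons[OF assms(1)])
    show "independent_along I as" by (rule Cons.IH, rule Cons.prems) auto
  qed (rule Cons.prems, auto)
qed

section \<open>Small correlations along sums imply strong mixing\<close>

text \<open>
  Indices range over an arbitrary infinite set \<open>Y\<close>, so that passing to a subsequence, as in
  Ramsey's theorem, needs no reindexing.
\<close>

definition small_correlations :: "nat \<Rightarrow> bool" where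
  "small_correlations r \<longleftrightarrow>
    (\<forall>bs Y A\<^sub>0 A\<^sub>1 \<epsilon>. length bs = r \<longrightarrow> (\<forall>b\<in>set bs. filterlim b cofinite sequentially) \<longrightarrow> infinite Y \<longrightarrow>
      A\<^sub>0 \<in> events \<longrightarrow> A\<^sub>1 \<in> events \<longrightarrow> 0 < \<epsilon> \<longrightarrow>
      (\<exists>ks. length ks = r \<and> sorted_wrt (<) ks \<and> set ks \<subseteq> Y \<and>
        \<bar>prob (A\<^sub>0 \<inter> T (\<Sum>(b, k)\<leftarrow>zip bs ks. b k) ` A\<^sub>1) - prob A\<^sub>0 * prob A\<^sub>1\<bar> < \<epsilon>))"

lemma small_correlationsD:
  assumes "small_correlations r" "length bs = r" "\<And>b. b \<in> set bs \<Longrightarrow> filterlim b cofinite sequentially"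
    "infinite Y" "A\<^sub>0 \<in> events" "A\<^sub>1 \<in> events" "0 < \<epsilon>"
  obtains ks where "length ks = r" "sorted_wrt (<) ks" "set ks \<subseteq> Y"
    "\<bar>prob (A\<^sub>0 \<inter> T (\<Sum>(b, k)\<leftarrow>zip bs ks. b k) ` A\<^sub>1) - prob A\<^sub>0 * prob A\<^sub>1\<bar> < \<epsilon>"
proof -
  obtain ks where "length ks = r \<and> sorted_wrt (<) ks \<and> set ks \<subseteq> Y \<and>
      \<bar>prob (A\<^sub>0 \<inter> T (\<Sum>(b, k)\<leftarrow>zip bs ks. b k) ` A\<^sub>1) - prob A\<^sub>0 * prob A\<^sub>1\<bar> < \<epsilon>"
    using assms(1)[unfolded small_correlations_def, rule_format, OF assms(2-7)] ..
  then show thesis by (intro that[of ks]) simp_all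
qed

text \<open>The first summand is fixed and moved to the set \<open>A\<^sub>0\<close> by invariance of the measure.\<close>

lemma small_correlations_Suc:
  assumes "small_correlations r"
  shows "small_correlations (Suc r)"
  unfolding small_correlations_def
proof (intro allI impI)
  fix bs :: "(nat \<Rightarrow> 'g) list" and Y :: "nat set" and A\<^sub>0 A\<^sub>1 and \<epsilon> :: real
  assume *: "length bs = Suc r" "\<forall>b\<in>set bs. filterlim b cofinite sequentially" "infinite Y"
    "A\<^sub>0 \<in> events" "A\<^sub>1 \<in> events" "0 < \<epsilon>"
  then obtain b bs' where bs: "bs = b # bs'" "length bs' = r" by (auto simp: length_Suc_conv)
  obtain k where k: "k \<in> Y" using *(3) by (metis finite.emptyI ex_in_conv)
  have "infinite (Y \<inter> {k<..})"
  proof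
    assume "finite (Y \<inter> {k<..})"
    then have "finite (Y \<inter> {k<..} \<union> {..k})" by simp
    moreover have "Y \<subseteq> Y \<inter> {k<..} \<union> {..k}" by auto
    ultimately show False using *(3) finite_subset by blast
  qed
  from small_correlationsD[OF assms bs(2) _ this sets_act_image[OF *(4), of "- b k"] *(5,6)] *(2) bs(1)
  obtain ks where ks: "length ks = r" "sorted_wrt (<) ks" "set ks \<subseteq> Y \<inter> {k<..}"
    "\<bar>prob (T (- b k) ` A\<^sub>0 \<inter> T (\<Sum>(b, k)\<leftarrow>zip bs' ks. b k) ` A\<^sub>1) - prob (T (- b k) ` A\<^sub>0) * prob A\<^sub>1\<bar> < \<epsilon>"
    by auto
  have "prob (A\<^sub>0 \<inter> T (b k + (\<Sum>(b, k)\<leftarrow>zip bs' ks. b k)) ` A\<^sub>1)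
      = prob (T (- b k) ` A\<^sub>0 \<inter> T (\<Sum>(b, k)\<leftarrow>zip bs' ks. b k) ` A\<^sub>1)"
    using prob_Int_act_image[OF *(4,5), of "- b k" "b k + (\<Sum>(b, k)\<leftarrow>zip bs' ks. b k)"] by simp
  then show "\<exists>ks. length ks = Suc r \<and> sorted_wrt (<) ks \<and> set ks \<subseteq> Y \<and>
        \<bar>prob (A\<^sub>0 \<inter> T (\<Sum>(b, k)\<leftarrow>zip bs ks. b k) ` A\<^sub>1) - prob A\<^sub>0 * prob A\<^sub>1\<bar> < \<epsilon>"
    using ks k bs *(4) by (intro exI[of _ "k # ks"]) auto
qed

text \<open>
  The inner product of the translates by \<open>v ks\<close> and \<open>v ks'\<close> is a correlation at \<open>v ks' - v ks\<close>, a sum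
  of \<open>2r\<close> terms. The hypothesis excludes an infinite set on which all these correlations are
  large, so Ramsey's theorem supplies one on which all are small.
\<close>

lemma small_correlations_halve:
  assumes "small_correlations (r + r)"
  shows "small_correlations r"
  unfolding small_correlations_def
proof (intro allI impI)
  fix bs :: "(nat \<Rightarrow> 'g) list" and Y :: "nat set" and A\<^sub>0 A\<^sub>1 and \<epsilon> :: real
  assume *: "length bs = r" "\<forall>b\<in>set bs. filterlim b cofinite sequentially" "infinite Y"
    "A\<^sub>0 \<in> events" "A\<^sub>1 \<in> events" "0 < \<epsilon>"
  define v where "v ks = (\<Sum>(b, k)\<leftarrow>zip bs ks. b k)" for ks
  define cs where "cs = map (\<lambda>b k. - b k) bs @ bs"
  have len: "length cs = r + r" using *(1) by (simp add: cs_def)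
  have cs_sum: "(\<Sum>(b, k)\<leftarrow>zip cs (ks @ ks'). b k) = - v ks + v ks'" if "length ks = r" for ks ks'
  proof -
    have "(\<Sum>(b, k)\<leftarrow>zip (map (\<lambda>b k. - b k) bs) ks. b k) = - v ks"
      unfolding v_def zip_map1 by (simp add: uminus_sum_list_map o_def case_prod_unfold)
    then show ?thesis
      using that *(1) unfolding cs_def v_def by (simp add: zip_append)
  qed
  have cs_lim: "filterlim b cofinite sequentially" if "b \<in> set cs" for b
    using that *(2) unfolding cs_def by (auto intro: filterlim_uminus_cofinite)
  define \<eta> where "\<eta> = \<epsilon> / 2"
  have \<eta>: "0 < \<eta>" "\<eta> < \<epsilon>" using *(6) by (auto simp: \<eta>_def)
  define \<delta> where "\<delta> = \<eta>\<^sup>2 / 6"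
  have \<delta>: "0 < \<delta>" using \<eta> by (simp add: \<delta>_def)
  \<comment> \<open>the colouring of index sets of size \<open>2r\<close>\<close>
  define good where "good ks \<longleftrightarrow>
      \<bar>prob (A\<^sub>1 \<inter> T (\<Sum>(b, k)\<leftarrow>zip cs ks. b k) ` A\<^sub>1) - prob A\<^sub>1 * prob A\<^sub>1\<bar> < \<delta>" for ks
  obtain Z t where Z: "Z \<subseteq> Y" "infinite Z"
    and t: "\<forall>X. X \<subseteq> Z \<and> finite X \<and> card X = r + r \<longrightarrow> of_bool (good (sorted_list_of_set X)) = (t :: nat)"
    using Ramsey[of Y "r + r" "\<lambda>X. of_bool (good (sorted_list_of_set X))" 2] *(3)
    by (elim exE conjE impE meta_impE) (auto simp: of_bool_def)
  have hom: "of_bool (good ks) = t" if "sorted_wrt (<) ks" "length ks = r + r" "set ks \<subseteq> Z" for ks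
  proof -
    have "distinct ks" "sorted ks" using that(1) by (auto simp: strict_sorted_iff)
    then have "sorted_list_of_set (set ks) = ks" "card (set ks) = r + r"
      using that(2) by (auto simp: sorted_list_of_set.idem_if_sorted_distinct distinct_card)
    then show ?thesis using t that(3) by (metis List.finite_set)
  qed
  from small_correlationsD[OF assms len cs_lim Z(2) *(5,5) \<delta>]
  obtain ks where "length ks = r + r" "sorted_wrt (<) ks" "set ks \<subseteq> Z" "good ks"
    unfolding good_def by blast
  with hom have "t = 1" by fastforce
  with hom have good: "good ks" if "sorted_wrt (<) ks" "length ks = r + r" "set ks \<subseteq> Z" for ks
    using that \<open>t = 1\<close> by (metis of_bool_eq_1_iff)
  \<comment> \<open>consecutive blocks of length \<open>r\<close>: two of them concatenate to an increasing list\<close>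
  define block where "block i = map (enumerate Z) [i * r..<i * r + r]" for i
  have mono: "enumerate Z m < enumerate Z n \<longleftrightarrow> m < n" for m n
    using Z(2) by (simp add: enumerate_mono_iff)
  have block: "length (block i) = r" "set (block i) \<subseteq> Z" "sorted_wrt (<) (block i)" for i
    using Z(2) by (auto simp: block_def enumerate_in_set sorted_wrt_map mono)
  have block_app: "sorted_wrt (<) (block i @ block j)" if "i < j" for i j
  proof -
    have "i * r + r \<le> j * r" using that mult_le_mono1[of "Suc i" j r] by simp
    then show ?thesis
      using block(3)[of i] block(3)[of j] by (auto simp: sorted_wrt_append) (auto simp: block_def mono)
  qed
  define W where "W i = T (v (block i)) ` A\<^sub>1" for i
  have pair_less: "\<bar>prob (W i \<inter> W j) - (prob A\<^sub>1)\<^sup>2\<bar> \<le> \<delta>" if "i < j" for i j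
  proof -
    have "good (block i @ block j)"
      using block block_app[OF that] by (intro good) auto
    moreover have "prob (W i \<inter> W j) = prob (A\<^sub>1 \<inter> T (- v (block i) + v (block j)) ` A\<^sub>1)"
      unfolding W_def
      using prob_Int_act_image[OF *(5,5), of "v (block i)" "- v (block i) + v (block j)"] by simp
    ultimately show ?thesis
      unfolding good_def by (simp add: cs_sum block power2_eq_square)
  qed
  have pair: "\<bar>prob (W i \<inter> W j) - (prob A\<^sub>1)\<^sup>2\<bar> \<le> \<delta>" if "i \<noteq> j" for i j
    using pair_less[of i j] pair_less[of j i] that by (cases "i < j") (auto simp: Int_commute)
  define N where "N = nat \<lceil>2 / \<eta>\<^sup>2\<rceil> + 1"
  have N_pos: "0 < N" unfolding N_def by simp
  have "2 / \<eta>\<^sup>2 \<le> real N" unfolding N_def by linarith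
  then have N: "2 \<le> \<eta>\<^sup>2 * card {..<N}" using \<eta> by (simp add: field_simps)
  have "(\<Sum>i<N. \<bar>prob (A\<^sub>0 \<inter> W i) - prob A\<^sub>1 * prob A\<^sub>0\<bar>) \<le> \<eta> * card {..<N}"
    by (rule sum_abs_correlation_le[OF _ _ *(4) _ _ \<delta>_def \<eta>(1) N])
      (use *(5) \<delta> pair in \<open>auto simp: W_def\<close>)
  moreover have "(\<Sum>i<N. \<epsilon>) > \<eta> * card {..<N}"
    using mult_strict_right_mono[OF \<eta>(2), of "real N"] by (simp add: N_pos mult.commute)
  ultimately have "(\<Sum>i<N. \<bar>prob (A\<^sub>0 \<inter> W i) - prob A\<^sub>1 * prob A\<^sub>0\<bar>) < (\<Sum>i<N. \<epsilon>)"
    by (rule le_less_trans)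
  then have "\<exists>i. \<bar>prob (A\<^sub>0 \<inter> W i) - prob A\<^sub>1 * prob A\<^sub>0\<bar> < \<epsilon>"
    by (meson not_le sum_mono)
  then obtain i where "\<bar>prob (A\<^sub>0 \<inter> W i) - prob A\<^sub>1 * prob A\<^sub>0\<bar> < \<epsilon>" by blast
  then show "\<exists>ks. length ks = r \<and> sorted_wrt (<) ks \<and> set ks \<subseteq> Y \<and>
        \<bar>prob (A\<^sub>0 \<inter> T (\<Sum>(b, k)\<leftarrow>zip bs ks. b k) ` A\<^sub>1) - prob A\<^sub>0 * prob A\<^sub>1\<bar> < \<epsilon>"
    using block[of i] Z(1) by (intro exI[of _ "block i"]) (auto simp: W_def v_def mult.commute)
qed

text \<open>
  The number of summands descends from \<open>n + 1\<close> to \<open>n\<close> for \<open>n \<ge> 1\<close> by first raising it to \<open>2n\<close>.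
\<close>

lemma small_correlations_one:
  assumes "small_correlations (Suc r)"
  shows "small_correlations 1"
  using assms
proof (induction r)
  case (Suc r)
  have "small_correlations (Suc (Suc r) + n)" for n
    by (induction n) (use Suc.prems small_correlations_Suc in auto)
  from this[of r] have "small_correlations (Suc r + Suc r)" by simp
  then show ?case by (rule Suc.IH[OF small_correlations_halve])
qed simp

lemma strongly_mixing_if_small_correlations_one:
  assumes "small_correlations 1"
  shows "strongly_mixing M T"
  unfolding strongly_mixing_def
proof (intro ballI tendstoI)
  fix A\<^sub>0 A\<^sub>1 and \<epsilon> :: real
  assume A: "A\<^sub>0 \<in> events" "A\<^sub>1 \<in> events" and \<epsilon>: "0 < \<epsilon>"
  define D where "D = {g. \<not> dist (prob (A\<^sub>0 \<inter> T g ` A\<^sub>1)) (prob A\<^sub>0 * prob A\<^sub>1) < \<epsilon>}"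
  have "finite D"
  proof (rule ccontr)
    assume "infinite D"
    then obtain b :: "nat \<Rightarrow> 'g" where b: "inj b" "range b \<subseteq> D"
      by (meson infinite_countable_subset)
    from small_correlationsD[OF assms _ _ infinite_UNIV_nat A \<epsilon>, of "[b]"] filterlim_inj_cofinite[OF b(1)]
    obtain ks where ks: "length ks = 1"
      "\<bar>prob (A\<^sub>0 \<inter> T (\<Sum>(b, k)\<leftarrow>zip [b] ks. b k) ` A\<^sub>1) - prob A\<^sub>0 * prob A\<^sub>1\<bar> < \<epsilon>" by auto
    then obtain k where "ks = [k]" by (auto simp: length_Suc_conv)
    then have "b k \<notin> D" using ks(2) by (simp add: D_def dist_real_def)
    then show False using b(2) by auto
  qed
  then show "\<forall>\<^sub>F g in cofinite. dist (prob (A\<^sub>0 \<inter> T g ` A\<^sub>1)) (prob A\<^sub>0 * prob A\<^sub>1) < \<epsilon>"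
    by (simp add: eventually_cofinite D_def)
qed

section \<open>Sums of sequences of tuples\<close>

text \<open>
  The set \<open>A 0\<close>, which is not translated, becomes a coordinate \<open>0\<close> whose shifts are all zero; the
  differences with coordinate \<open>0\<close> tend to infinity because the coordinates themselves do.
\<close>

lemma strongly_mixing_imp_Sigma_tilde_star:
  assumes "strongly_mixing M T" and A: "\<forall>j\<in>{0..l}. A j \<in> events" and "0 < \<epsilon>"
  shows "Sigma_tilde_star l l (mixing_returns M T l A \<epsilon>)"
  unfolding Sigma_tilde_star_def
proof (intro conjI allI impI)
  show "mixing_returns M T l A \<epsilon> \<subseteq> tuples l" by (auto simp: mixing_returns_def)
  fix E :: "(nat \<Rightarrow> 'g) set" assume "Sigma_tilde_set l l E"
  then obtain g where
      lim: "\<And>j t. j \<in> {1..l} \<Longrightarrow> t \<in> {1..l} \<Longrightarrow> filterlim (\<lambda>k. g j k t) cofinite sequentially"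
    and diff: "\<And>j t t'. j \<in> {1..l} \<Longrightarrow> t \<in> {1..l} \<Longrightarrow> t' \<in> {1..l} \<Longrightarrow> t \<noteq> t' \<Longrightarrow>
          filterlim (\<lambda>k. g j k t - g j k t') cofinite sequentially"
    and E: "E = {\<lambda>t\<in>{1..l}. \<Sum>j=1..l. g j (k j) t | k :: nat \<Rightarrow> nat.
            k \<in> {1..l} \<rightarrow> {1..} \<and> strict_mono_on {1..l} k}"
    unfolding Sigma_tilde_set_def by blast
  define as where "as = map (\<lambda>j k t. if t = 0 then 0 else g (Suc j) k t) [0..<l]"
  have "\<exists>ks. length ks = length as \<and> sorted_wrt (<) (0 # ks) \<and>
          (\<forall>(S, A)\<in>{({0..l}, A)}. \<bar>prob (\<Inter>t\<in>S. T (\<Sum>(a, k)\<leftarrow>zip as ks. a k t) ` A t) - (\<Prod>t\<in>S. prob (A t))\<bar> < \<epsilon>)"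
  proof (rule independent_alongD)
    show "independent_along {0..l} as"
    proof (rule independent_along_if_strongly_mixing[OF assms(1)])
      fix a t t' assume a: "a \<in> set as" and t: "t \<in> {0..l}" "t' \<in> {0..l}" "t \<noteq> t'"
      then obtain j' where "j' < l" "a = (\<lambda>k t. if t = 0 then 0 else g (Suc j') k t)"
        by (auto simp: as_def)
      then obtain j where j: "j \<in> {1..l}" "a = (\<lambda>k t. if t = 0 then 0 else g j k t)"
        by (intro that[of "Suc j'"]) auto
      show "filterlim (\<lambda>k. a k t - a k t') cofinite sequentially"
        using t lim[OF j(1), of t] filterlim_uminus_cofinite[OF lim[OF j(1), of t']] diff[OF j(1), of t t']
        unfolding j(2) by (cases "t = 0"; cases "t' = 0") simp_all
    qed
  qed (use A \<open>0 < \<epsilon>\<close> in \<open>auto simp: as_def\<close>)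
  then obtain ks where ks: "length ks = l" "sorted_wrt (<) (0 # ks)"
    and close: "\<bar>prob (\<Inter>t\<in>{0..l}. T (\<Sum>(a, k)\<leftarrow>zip as ks. a k t) ` A t) - (\<Prod>t\<in>{0..l}. prob (A t))\<bar> < \<epsilon>"
    by (auto simp: as_def)
  define k where "k j = ks ! (j - 1)" for j
  define x where "x = (\<lambda>t\<in>{1..l}. \<Sum>j=1..l. g j (k j) t)"
  have sum: "(\<Sum>(a, k)\<leftarrow>zip as ks. a k t) = (if t = 0 then 0 else \<Sum>j=1..l. g j (k j) t)" for t
  proof -
    have "(\<Sum>(a, k)\<leftarrow>zip as ks. a k t) = (\<Sum>j<l. if t = 0 then 0 else g (Suc j) (ks ! j) t)"
      using ks(1) by (subst sum_list_sum_nth) (auto simp: as_def atLeast0LessThan intro!: sum.cong)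
    also have "\<dots> = (if t = 0 then 0 else \<Sum>j<l. g (Suc j) (k (Suc j)) t)"
      by (simp add: k_def)
    also have "(\<Sum>j<l. g (Suc j) (k (Suc j)) t) = (\<Sum>j=1..l. g j (k j) t)"
      by (simp add: sum.atLeast1_atMost_eq)
    finally show ?thesis .
  qed
  have "x \<in> E"
  proof -
    have "k \<in> {1..l} \<rightarrow> {1..}"
      using ks by (auto simp: k_def Suc_le_eq)
    moreover have "strict_mono_on {1..l} k"
      using ks by (auto simp: strict_mono_on_def k_def intro!: sorted_wrt_nth_less[of "(<)" ks])
    ultimately show ?thesis unfolding E x_def by blast
  qed
  moreover have "x \<in> mixing_returns M T l A \<epsilon>"
  proof -
    have "{0..l} = insert 0 {1..l}" by auto
    then have "(\<Inter>t\<in>{0..l}. T (\<Sum>(a, k)\<leftarrow>zip as ks. a k t) ` A t) = A 0 \<inter> (\<Inter>t\<in>{1..l}. T (x t) ` A t)"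
      by (simp add: sum act_zero x_def)
    then show ?thesis
      using close by (simp add: mixing_returns_def tuples_def x_def)
  qed
  ultimately show "mixing_returns M T l A \<epsilon> \<inter> E \<noteq> {}" by blast
qed

text \<open>
  The given sequences become the first coordinates of sequences of tuples. The sets in the other
  coordinates are the whole space, so only the first coordinate of the sum matters.
\<close>

lemma Sigma_tilde_star_imp_small_correlations:
  assumes l: "1 \<le> l"
    and star: "\<And>A \<epsilon>. \<forall>j\<in>{0..l}. A j \<in> events \<Longrightarrow> 0 < \<epsilon> \<Longrightarrow>
      Sigma_tilde_star l l (mixing_returns M T l A \<epsilon>)"
  shows "small_correlations l"
  unfolding small_correlations_def
proof (intro allI impI)
  fix bs :: "(nat \<Rightarrow> 'g) list" and Y :: "nat set" and A\<^sub>0 A\<^sub>1 and \<epsilon> :: real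
  assume *: "length bs = l" "\<forall>b\<in>set bs. filterlim b cofinite sequentially" "infinite Y"
    "A\<^sub>0 \<in> events" "A\<^sub>1 \<in> events" "0 < \<epsilon>"
  define b where "b j k = (bs ! (j - 1)) (enumerate Y k)" for j k
  have b: "filterlim (b j) cofinite sequentially" if "j \<in> {1..l}" for j
  proof -
    have "filterlim (bs ! (j - 1)) cofinite sequentially"
      using *(1,2) that by auto
    then show ?thesis
      unfolding b_def using filterlim_subseq[OF strict_mono_enumerate[OF *(3)]] by (rule filterlim_compose)
  qed
  have "\<forall>j\<in>{1..l}. \<exists>h. h 1 = b j \<and> (\<forall>t\<in>{1..l}. filterlim (h t) cofinite sequentially) \<and>
    (\<forall>t\<in>{1..l}. \<forall>t'\<in>{1..l}. t \<noteq> t' \<longrightarrow> filterlim (\<lambda>k. h t k - h t' k) cofinite sequentially)"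
    using ex_generic_tuple_sequence[OF b] by blast
  from bchoice[OF this] obtain h where H: "\<forall>j\<in>{1..l}. h j 1 = b j \<and> (\<forall>t\<in>{1..l}. filterlim (h j t) cofinite sequentially) \<and>
    (\<forall>t\<in>{1..l}. \<forall>t'\<in>{1..l}. t \<noteq> t' \<longrightarrow> filterlim (\<lambda>k. h j t k - h j t' k) cofinite sequentially)"
    by blast
  then have h: "\<And>j. j \<in> {1..l} \<Longrightarrow> h j 1 = b j"
    "\<And>j t. j \<in> {1..l} \<Longrightarrow> t \<in> {1..l} \<Longrightarrow> filterlim (h j t) cofinite sequentially"
    "\<And>j t t'. j \<in> {1..l} \<Longrightarrow> t \<in> {1..l} \<Longrightarrow> t' \<in> {1..l} \<Longrightarrow> t \<noteq> t' \<Longrightarrow>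
      filterlim (\<lambda>k. h j t k - h j t' k) cofinite sequentially"
    by blast+
  define g where "g j k = (\<lambda>t\<in>{1..l}. h j t k)" for j k
  define E where "E = {\<lambda>t\<in>{1..l}. \<Sum>j=1..l. g j (k j) t | k :: nat \<Rightarrow> nat.
            k \<in> {1..l} \<rightarrow> {1..} \<and> strict_mono_on {1..l} k}"
  have "Sigma_tilde_set l l E"
    unfolding Sigma_tilde_set_def E_def
    by (intro exI[of _ g] conjI ballI allI impI refl) (auto simp: g_def tuples_def h)
  moreover define A where "A j = (if j = 0 then A\<^sub>0 else if j = 1 then A\<^sub>1 else UNIV)" for j :: nat
  have "\<forall>j\<in>{0..l}. A j \<in> events"
    using *(4,5) sets.top[of M] by (auto simp: A_def space_UNIV)
  ultimately have "mixing_returns M T l A \<epsilon> \<inter> E \<noteq> {}"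
    using star[of A \<epsilon>] *(6) unfolding Sigma_tilde_star_def by blast
  then obtain k where k: "k \<in> {1..l} \<rightarrow> {1..}" "strict_mono_on {1..l} k"
    and ret: "(\<lambda>t\<in>{1..l}. \<Sum>j=1..l. g j (k j) t) \<in> mixing_returns M T l A \<epsilon>"
    unfolding E_def by blast
  define ks where "ks = map (\<lambda>j. enumerate Y (k (Suc j))) [0..<l]"
  have one: "1 \<in> {1..l}" using l by simp
  have "{1..l} = insert 1 {2..l}" using l by auto
  have surj: "T y ` UNIV = UNIV" for y
    by (simp add: act_image_eq_vimage)
  have "(\<Sum>(b, k)\<leftarrow>zip bs ks. b k) = (\<Sum>j<l. b (Suc j) (k (Suc j)))"
    using *(1) by (subst sum_list_sum_nth) (simp add: ks_def b_def atLeast0LessThan)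
  also have "\<dots> = (\<Sum>j=1..l. b j (k j))"
    by (simp add: sum.atLeast1_atMost_eq)
  also have "\<dots> = (\<Sum>j=1..l. g j (k j) 1)"
    using one h(1) by (intro sum.cong) (auto simp: g_def)
  finally have sum: "(\<Sum>(b, k)\<leftarrow>zip bs ks. b k) = (\<Sum>j=1..l. g j (k j) 1)" .
  have "A 0 \<inter> (\<Inter>t\<in>{1..l}. T (\<Sum>j=1..l. g j (k j) t) ` A t) = A\<^sub>0 \<inter> T (\<Sum>(b, k)\<leftarrow>zip bs ks. b k) ` A\<^sub>1"
    unfolding sum \<open>{1..l} = insert 1 {2..l}\<close> by (auto simp: A_def surj)
  moreover have "(\<Prod>j=0..l. prob (A j)) = prob A\<^sub>0 * prob A\<^sub>1"
  proof -
    have "{0..l} = insert 0 (insert 1 {2..l})" using l by auto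
    then have "(\<Prod>j=0..l. prob (A j)) = prob A\<^sub>0 * (prob A\<^sub>1 * (\<Prod>j=2..l. prob (A j)))"
      by (simp add: A_def)
    also have "(\<Prod>j=2..l. prob (A j)) = 1"
      using prob_space by (intro prod.neutral) (auto simp: A_def space_UNIV)
    finally show ?thesis by simp
  qed
  ultimately have close: "\<bar>prob (A\<^sub>0 \<inter> T (\<Sum>(b, k)\<leftarrow>zip bs ks. b k) ` A\<^sub>1) - prob A\<^sub>0 * prob A\<^sub>1\<bar> < \<epsilon>"
    using ret unfolding mixing_returns_def by simp
  have ks: "length ks = l" "set ks \<subseteq> Y"
    using enumerate_in_set[OF *(3)] by (auto simp: ks_def)
  have "sorted_wrt (<) ks"
    using k(2) *(3) by (auto simp: ks_def sorted_wrt_iff_nth_less enumerate_mono_iff strict_mono_on_def)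
  with ks close show "\<exists>ks. length ks = l \<and> sorted_wrt (<) ks \<and> set ks \<subseteq> Y \<and>
        \<bar>prob (A\<^sub>0 \<inter> T (\<Sum>(b, k)\<leftarrow>zip bs ks. b k) ` A\<^sub>1) - prob A\<^sub>0 * prob A\<^sub>1\<bar> < \<epsilon>"
    by (intro exI[of _ ks] conjI)
qed

end

theorem theorem1p11:
  fixes M :: "'x::metric_space measure"
    and T :: "'g::{ab_group_add,countable} \<Rightarrow> 'x \<Rightarrow> 'x"
  assumes "measure_preserving_system M T"
  shows "(strongly_mixing M T \<longleftrightarrow>
           (\<forall>l\<ge>1. \<forall>A. (\<forall>j\<in>{0..l}. A j \<in> sets M) \<longrightarrow>
             (\<forall>\<epsilon>>0. Sigma_tilde_star l l (mixing_returns M T l A \<epsilon>))))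
       \<and> (strongly_mixing M T \<longleftrightarrow>
           (\<exists>l\<ge>1. \<forall>A. (\<forall>j\<in>{0..l}. A j \<in> sets M) \<longrightarrow>
             (\<forall>\<epsilon>>0. Sigma_tilde_star l l (mixing_returns M T l A \<epsilon>))))"
proof -
  interpret measure_preserving_system M T by (rule assms)
  let ?star = "\<lambda>l. \<forall>A. (\<forall>j\<in>{0..l}. A j \<in> sets M) \<longrightarrow>
             (\<forall>\<epsilon>>0. Sigma_tilde_star l l (mixing_returns M T l A \<epsilon>))"
  have forward: "?star l" if "strongly_mixing M T" for l
    using strongly_mixing_imp_Sigma_tilde_star[OF that] by blast
  have backward: "strongly_mixing M T" if "1 \<le> l" "?star l" for l
  proof -
    have "small_correlations l"
      using that by (intro Sigma_tilde_star_imp_small_correlations) auto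
    then have "small_correlations 1"
      using that(1) small_correlations_one[of "l - 1"] by simp
    then show ?thesis by (rule strongly_mixing_if_small_correlations_one)
  qed
  show ?thesis
  proof (rule conjI; rule iffI)
    assume "strongly_mixing M T"
    then show "\<forall>l\<ge>1. ?star l" by (intro allI[of "\<lambda>l. 1 \<le> l \<longrightarrow> ?star l"] impI[of "1 \<le> _"] forward)
  next
    assume "\<forall>l\<ge>1. ?star l"
    then have "?star 1" by (rule allE[where x = 1]) (erule mp, simp)
    then show "strongly_mixing M T" by (rule backward[OF order_refl])
  next
    assume "strongly_mixing M T"
    then have "?star 1" by (rule forward)
    then show "\<exists>l\<ge>1. ?star l" by (rule exI[of _ 1, OF conjI[OF order_refl]])
  next
    assume "\<exists>l\<ge>1. ?star l"
    then show "strongly_mixing M T" by (elim exE conjE) (rule backward)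
  qed
qed

end
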